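(* Let $$S_{\mathrm{D}}=\max_{\mathbf{v}^{[kl]},p^{[kl]}}\ \min_{k,l}\ \Gamma^{[kl]}(\mathbf{v}^{[11]},\dots,\mathbf{v}^{[KL]},\mathbf{p}),\qquad S_{\mathrm{U}}=\max_{\mathbf{w}^{[kl]},p_{\mathrm{U}}^{[kl]}}\ \min_{k,l}\ \Gamma_{\mathrm{U}}^{[kl]}(\mathbf{w}^{[11]},\dots,\mathbf{w}^{[KL]},\mathbf{p}_{\mathrm{U}}).$$ 1. $S_{\mathrm{D}}=S_{\mathrm{U}}$. 2. Let $\mathbf{w}_*^{[kl]}$ be uplink beamforming vectors and $\mathbf{p}_{\mathrm{U},*}$ uplink powers such that $\Gamma_{\mathrm{U}}^{[nv]}(\mathbf{w}_*^{[11]},\dots,\mathbf{w}_*^{[KL]},\mathbf{p}_{\mathrm{U},*})=S_{\mathrm{U}}$ for all $n,v$. Put $\mathbf{v}_*^{[kl]}=\mathbf{w}_*^{[kl]}$ for all $k,l$. Then there exist downlink powers $\mathbf{p}_*=(p_*^{[kl]})_{k,l}$ such that $$\Gamma^{[nv]}(\mathbf{v}_*^{[11]},\dots,\mathbf{v}_*^{[KL]},\mathbf{p}_* )=S_{\mathrm{D}}\quad\text{for all } n,v.$$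
   Context: $K,L,M$ are positive integers; $\rho_f,\rho_r,\tau>0$ are real; $\beta_j^{[kl]}>0$ for $j,l\in\{1,\dots,L\}$, $k\in\{1,\dots,K\}$ (superscripts in square brackets are indices). Pairs $(k,l)$ range over $\{1,\dots,K\}\times\{1,\dots,L\}$. Let $\mathbf{b}^{[kl]}=(\beta_1^{[kl]},\dots,\beta_L^{[kl]})^T\in\mathbb{R}^L$ and $b_j^{[kln]}=\left(\frac{1}{\rho_f L}+\beta_j^{[kl]}\right)\left(\frac1{\rho_r\tau}+\sum_{s=1}^L\beta_j^{[ns]}\right)$. For $k,n\in\{1,\dots,K\}$, $l\in\{1,\dots,L\}$ let $\mathbf{Q}^{[kln]}\in\mathbb{R}^{L\times L}$ be $$\mathbf{Q}^{[kln]}=\tfrac1M\operatorname{diag}(b_1^{[kln]},\dots,b_L^{[kln]})+\delta_{kn}\,\mathbf{b}^{[kl]}\mathbf{b}^{[kl]T}.$$ Downlink: for nonzero beamforming vectors $\mathbf{v}^{[kl]}\in\mathbb{R}^L$ and powers $\mathbf{p}=(p^{[kl]})_{k,l}$, $p^{[kl]}>0$, $$\Gamma^{[kl]}(\mathbf{v}^{[11]},\dots,\mathbf{v}^{[KL]},\mathbf{p})=\frac{|\mathbf{b}^{[kl]T}\mathbf{v}^{[kl]}|^2p^{[kl]}}{\sum_{n=1}^K\sum_{j=1}^L\mathbf{v}^{[nj]T}\mathbf{Q}^{[kln]}\mathbf{v}^{[nj]}p^{[nj]}}.$$ Virtual uplink: for beamforming vectors $\mathbf{w}^{[kl]}\in\mathbb{R}^L$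 with $\|\mathbf{w}^{[kl]}\|=1$ and powers $\mathbf{p}_{\mathrm{U}}=(p_{\mathrm{U}}^{[kl]})_{k,l}$, $p_{\mathrm{U}}^{[kl]}>0$, $$\Gamma_{\mathrm{U}}^{[kl]}(\mathbf{w}^{[11]},\dots,\mathbf{w}^{[KL]},\mathbf{p}_{\mathrm{U}})=\frac{p_{\mathrm{U}}^{[kl]}|\mathbf{b}^{[kl]T}\mathbf{w}^{[kl]}|^2}{\mathbf{w}^{[kl]T}\left(\sum_{n=1}^K\sum_{j=1}^L\mathbf{Q}^{[njk]}p_{\mathrm{U}}^{[nj]}\right)\mathbf{w}^{[kl]}}.$$ The maxima are over all such beamforming vectors and powers. *)

theory Defs
  imports "HOL-Analysis.Analysis"
begin

text \<open>
  The index sets \<open>{1..K}\<close> and \<open>{1..L}\<close> are the finite types \<open>'k\<close> and \<open>'l\<close>, so \<open>L\<close> is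
  \<open>CARD('l)\<close> and \<open>real ^ 'l\<close> is the space of beamforming vectors. The upper indices of
  \<open>\<beta>\<close> come first: \<open>\<beta> k l j\<close> is $\beta_j^{[kl]}$.
\<close>

definition bvec :: "('k::finite \<Rightarrow> 'l::finite \<Rightarrow> 'l \<Rightarrow> real) \<Rightarrow> 'k \<Rightarrow> 'l \<Rightarrow> real ^ 'l" where
  "bvec \<beta> k l = (\<chi> j. \<beta> k l j)"

definition bcoef ::
  "real \<Rightarrow> real \<Rightarrow> real \<Rightarrow> ('k::finite \<Rightarrow> 'l::finite \<Rightarrow> 'l \<Rightarrow> real) \<Rightarrow> 'k \<Rightarrow> 'l \<Rightarrow> 'k \<Rightarrow> 'l \<Rightarrow> real"
where
  "bcoef \<rho>\<^sub>f \<rho>\<^sub>r \<tau> \<beta> k l n j =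
     (1 / (\<rho>\<^sub>f * real CARD('l)) + \<beta> k l j) * (1 / (\<rho>\<^sub>r * \<tau>) + (\<Sum>s\<in>UNIV. \<beta> n s j))"

definition Qmat ::
  "nat \<Rightarrow> real \<Rightarrow> real \<Rightarrow> real \<Rightarrow> ('k::finite \<Rightarrow> 'l::finite \<Rightarrow> 'l \<Rightarrow> real)
     \<Rightarrow> 'k \<Rightarrow> 'l \<Rightarrow> 'k \<Rightarrow> real ^ 'l ^ 'l"
where
  "Qmat M \<rho>\<^sub>f \<rho>\<^sub>r \<tau> \<beta> k l n =
     (1 / real M) *\<^sub>R (\<chi> i j. if i = j then bcoef \<rho>\<^sub>f \<rho>\<^sub>r \<tau> \<beta> k l n j else 0)
     + (if k = n then 1 else 0) *\<^sub>R (\<chi> i j. bvec \<beta> k l $ i * bvec \<beta> k l $ j)"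

definition SINR_down ::
  "nat \<Rightarrow> real \<Rightarrow> real \<Rightarrow> real \<Rightarrow> ('k::finite \<Rightarrow> 'l::finite \<Rightarrow> 'l \<Rightarrow> real)
     \<Rightarrow> ('k \<Rightarrow> 'l \<Rightarrow> real ^ 'l) \<Rightarrow> ('k \<Rightarrow> 'l \<Rightarrow> real) \<Rightarrow> 'k \<Rightarrow> 'l \<Rightarrow> real"
where
  "SINR_down M \<rho>\<^sub>f \<rho>\<^sub>r \<tau> \<beta> v p k l =
     \<bar>bvec \<beta> k l \<bullet> v k l\<bar>\<^sup>2 * p k l /
     (\<Sum>n\<in>UNIV. \<Sum>j\<in>UNIV. (v n j \<bullet> (Qmat M \<rho>\<^sub>f \<rho>\<^sub>r \<tau> \<beta> k l n *v v n j)) * p n j)"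

definition SINR_up ::
  "nat \<Rightarrow> real \<Rightarrow> real \<Rightarrow> real \<Rightarrow> ('k::finite \<Rightarrow> 'l::finite \<Rightarrow> 'l \<Rightarrow> real)
     \<Rightarrow> ('k \<Rightarrow> 'l \<Rightarrow> real ^ 'l) \<Rightarrow> ('k \<Rightarrow> 'l \<Rightarrow> real) \<Rightarrow> 'k \<Rightarrow> 'l \<Rightarrow> real"
where
  "SINR_up M \<rho>\<^sub>f \<rho>\<^sub>r \<tau> \<beta> w p k l =
     p k l * \<bar>bvec \<beta> k l \<bullet> w k l\<bar>\<^sup>2 /
     (w k l \<bullet> ((\<Sum>n\<in>UNIV. \<Sum>j\<in>UNIV. p n j *\<^sub>R Qmat M \<rho>\<^sub>f \<rho>\<^sub>r \<tau> \<beta> n j k) *v w k l))"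

definition min_over_pairs :: "('k::finite \<Rightarrow> 'l::finite \<Rightarrow> real) \<Rightarrow> real" where
  "min_over_pairs f = Min (range (\<lambda>(k, l). f k l))"

definition down_values ::
  "nat \<Rightarrow> real \<Rightarrow> real \<Rightarrow> real \<Rightarrow> ('k::finite \<Rightarrow> 'l::finite \<Rightarrow> 'l \<Rightarrow> real) \<Rightarrow> real set"
where
  "down_values M \<rho>\<^sub>f \<rho>\<^sub>r \<tau> \<beta> =
     {min_over_pairs (SINR_down M \<rho>\<^sub>f \<rho>\<^sub>r \<tau> \<beta> v p) | v p.
        (\<forall>k l. v k l \<noteq> 0) \<and> (\<forall>k l. p k l > 0)}"

definition up_values ::
  "nat \<Rightarrow> real \<Rightarrow> real \<Rightarrow> real \<Rightarrow> ('k::finite \<Rightarrow> 'l::finite \<Rightarrow> 'l \<Rightarrow> real) \<Rightarrow> real set"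
where
  "up_values M \<rho>\<^sub>f \<rho>\<^sub>r \<tau> \<beta> =
     {min_over_pairs (SINR_up M \<rho>\<^sub>f \<rho>\<^sub>r \<tau> \<beta> w p) | w p.
        (\<forall>k l. norm (w k l) = 1) \<and> (\<forall>k l. p k l > 0)}"

definition is_maximum :: "real \<Rightarrow> real set \<Rightarrow> bool" where
  "is_maximum s A \<longleftrightarrow> s \<in> A \<and> (\<forall>x\<in>A. x \<le> s)"

text \<open>
  \<open>GREATEST\<close> is the maximum only where one exists; existence has to be established
  separately, via \<open>is_maximum\<close>.
\<close>

definition S_down ::
  "nat \<Rightarrow> real \<Rightarrow> real \<Rightarrow> real \<Rightarrow> ('k::finite \<Rightarrow> 'l::finite \<Rightarrow> 'l \<Rightarrow> real) \<Rightarrow> real"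
where
  "S_down M \<rho>\<^sub>f \<rho>\<^sub>r \<tau> \<beta> = (GREATEST s. s \<in> down_values M \<rho>\<^sub>f \<rho>\<^sub>r \<tau> \<beta>)"

definition S_up ::
  "nat \<Rightarrow> real \<Rightarrow> real \<Rightarrow> real \<Rightarrow> ('k::finite \<Rightarrow> 'l::finite \<Rightarrow> 'l \<Rightarrow> real) \<Rightarrow> real"
where
  "S_up M \<rho>\<^sub>f \<rho>\<^sub>r \<tau> \<beta> = (GREATEST s. s \<in> up_values M \<rho>\<^sub>f \<rho>\<^sub>r \<tau> \<beta>)"

end

theory Submission
  imports Defs
begin

text \<open>
  For fixed beams the downlink ratio of pair \<open>i\<close> is \<open>g\<^sub>i p\<^sub>i / (A p)\<^sub>i\<close> with an entrywise positive
  coupling matrix \<open>A\<close>, and the uplink ratio is the same expression with \<open>A\<close> transposed.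
  If all \<open>g\<^sub>i > 0\<close>, a Perron vector \<open>q\<close> (from Brouwer's theorem) balances one link:
  \<open>g\<^sub>i q\<^sub>i = s (A q)\<^sub>i\<close>. Pairing this with powers \<open>p\<close> of the other link gives
  \<open>\<Sum>\<^sub>i p\<^sub>i g\<^sub>i q\<^sub>i = s p\<^sup>T A q\<close>, so no choice of \<open>p\<close> beats \<open>s\<close> there. Hence each positive value of one
  link is dominated by a balanced value of the other with the same beams, and for optimal uplink
  beams this squeezes the balanced downlink value to the common maximum. The uplink maximum exists
  by compactness once the powers are normalised to the closed simplex; its positivity excludes
  zero powers.
\<close>

section \<open>Positive coupling matrices\<close>

definition unit_simplex :: "(real ^ 'i::finite) set" where
  "unit_simplex = {p. (\<forall>i. 0 \<le> p $ i) \<and> (\<Sum>i\<in>UNIV. p $ i) = 1}"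

lemma unit_simplex_nth_le_1: "p \<in> unit_simplex \<Longrightarrow> p $ i \<le> 1"
  using member_le_sum[of i UNIV "($) p"] by (auto simp: unit_simplex_def)

lemma compact_unit_simplex: "compact (unit_simplex :: (real ^ 'i::finite) set)"
proof -
  have "closed (unit_simplex :: (real ^ 'i) set)"
    unfolding unit_simplex_def
    by (intro closed_Collect_conj closed_Collect_all closed_Collect_le closed_Collect_eq
        continuous_intros)
  moreover have "unit_simplex \<subseteq> cbox 0 (1 :: real ^ 'i)"
    by (auto simp: mem_box_cart unit_simplex_nth_le_1) (simp add: unit_simplex_def)
  ultimately show ?thesis
    using bounded_cbox bounded_subset compact_eq_bounded_closed by blast
qed

lemma convex_unit_simplex: "convex (unit_simplex :: (real ^ 'i::finite) set)"
  unfolding unit_simplex_def convex_def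
  by (auto simp: sum.distrib simp flip: sum_distrib_left)

text \<open>Entries of \<open>p\<close> may vanish, but since they sum to 1 at least one does not.
  This keeps denominators positive on the whole closed simplex.\<close>

lemma unit_simplex_sum_pos:
  assumes "p \<in> unit_simplex" and "\<And>i. a i > (0::real)"
  shows "(\<Sum>i\<in>UNIV. a i * p $ i) > 0"
proof -
  have nn: "\<And>i. 0 \<le> p $ i" and s1: "(\<Sum>i\<in>UNIV. p $ i) = 1"
    using assms(1) by (auto simp: unit_simplex_def)
  obtain i where "p $ i \<noteq> 0"
    using s1 by (metis sum.neutral zero_neq_one)
  then have "0 < a i * p $ i"
    using nn[of i] assms(2)[of i] by simp
  then show ?thesis
    using nn assms(2) by (intro sum_pos2[of _ i]) (auto simp: less_imp_le)
qed

lemma unit_simplex_nonempty: "unit_simplex \<noteq> ({} :: (real ^ 'i::finite) set)"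
proof -
  have "(\<chi> i. 1 / real CARD('i)) \<in> (unit_simplex :: (real ^ 'i) set)"
    by (simp add: unit_simplex_def)
  then show ?thesis by blast
qed

section \<open>Perron vectors of positive matrices\<close>

text \<open>The map sending \<open>p\<close> to \<open>B p\<close> divided by its coordinate sum
  preserves the simplex, so it has a fixed point \<open>q\<close>. The coordinate sum of
  \<open>B q\<close> is the eigenvalue, and \<open>q\<close> is strictly positive because it is a
  positive multiple of \<open>B q\<close>.\<close>

lemma positive_matrix_eigenvector:
  fixes B :: "'i::finite \<Rightarrow> 'i \<Rightarrow> real"
  assumes "\<And>i j. B i j > 0"
  obtains r q where "r > 0" "\<And>i. q i > 0" "\<And>i. (\<Sum>j\<in>UNIV. B i j * q j) = r * q i"
proof -
  define f where "f p i = (\<Sum>j\<in>UNIV. B i j * p $ j)" for p :: "real ^ 'i" and i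
  define c where "c p = (\<Sum>i\<in>UNIV. f p i)" for p
  have f_pos: "f p i > 0" if "p \<in> unit_simplex" for p i
    unfolding f_def using that assms by (rule unit_simplex_sum_pos)
  have c_pos: "c p > 0" if "p \<in> unit_simplex" for p
    unfolding c_def using f_pos[OF that] by (intro sum_pos) auto
  have "continuous_on unit_simplex (\<lambda>p. \<chi> i. f p i / c p)"
    using c_pos unfolding c_def f_def by (intro continuous_intros) (force simp: less_le)
  moreover have "(\<lambda>p. \<chi> i. f p i / c p) \<in> unit_simplex \<rightarrow> unit_simplex"
  proof
    fix p :: "real ^ 'i" assume p: "p \<in> unit_simplex"
    have "(\<Sum>i\<in>UNIV. f p i / c p) = 1"
      using c_pos[OF p] by (simp add: c_def flip: sum_divide_distrib)
    then show "(\<chi> i. f p i / c p) \<in> unit_simplex"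
      using f_pos[OF p] c_pos[OF p] by (simp add: unit_simplex_def less_imp_le)
  qed
  ultimately obtain q where q: "q \<in> unit_simplex" "(\<chi> i. f q i / c q) = q"
    using brouwer[OF compact_unit_simplex convex_unit_simplex unit_simplex_nonempty] by blast
  have nth: "q $ i = f q i / c q" for i
    using arg_cong[OF q(2), of "\<lambda>v. v $ i"] by simp
  show ?thesis
  proof (rule that)
    show "c q > 0" using q(1) by (rule c_pos)
    show "q $ i > 0" for i
      unfolding nth[of i] using f_pos c_pos q(1) by simp
    show "(\<Sum>j\<in>UNIV. B i j * q $ j) = c q * q $ i" for i
      using c_pos[OF q(1)] by (simp add: nth[of i] flip: f_def)
  qed
qed

section \<open>Ratios and transposition of the coupling matrix\<close>

definition ratio :: "('i::finite \<Rightarrow> real) \<Rightarrow> ('i \<Rightarrow> 'i \<Rightarrow> real) \<Rightarrow> ('i \<Rightarrow> real) \<Rightarrow> 'i \<Rightarrow> real" where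
  "ratio g A p i = g i * p i / (\<Sum>j\<in>UNIV. A i j * p j)"

lemma coupling_sum_pos:
  fixes A :: "'i::finite \<Rightarrow> 'i \<Rightarrow> real"
  assumes "\<And>i j. A i j > 0" "\<And>i. p i > 0"
  shows "(\<Sum>j\<in>UNIV. A i j * p j) > 0"
  using assms by (intro sum_pos) auto

text \<open>Dividing row \<open>i\<close> of \<open>A\<close> by \<open>g i\<close> turns balanced
  ratios into an eigenvector equation; an eigenvalue \<open>r\<close> gives the common ratio
  \<open>1 / r\<close>.\<close>

lemma ratio_eigenvector:
  assumes A: "\<And>i j. A i j > 0" and g: "\<And>i. g i > 0"
  obtains s q where "s > 0" "\<And>i. q i > 0" "\<And>i. ratio g A q i = s"
proof -
  obtain r q where r: "r > 0" "\<And>i. q i > 0" "\<And>i. (\<Sum>j\<in>UNIV. A i j / g i * q j) = r * q i"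
    using positive_matrix_eigenvector[of "\<lambda>i j. A i j / g i"] A g by (metis divide_pos_pos)
  have "(\<Sum>j\<in>UNIV. A i j * q j) = g i * (r * q i)" for i
    using g[of i] by (subst r(3)[symmetric]) (simp add: sum_distrib_left)
  then have "ratio g A q i = 1 / r" for i
    using r(1) r(2)[of i] g[of i] by (simp add: ratio_def)
  then show ?thesis using r by (intro that[of "1 / r" q]) auto
qed

text \<open>Each denominator cancels. The right-hand side is symmetric in \<open>p\<close> and
  \<open>q\<close>, which links the ratios for \<open>A\<close> with those for its
  transpose.\<close>

lemma ratio_pairing:
  assumes A: "\<And>i j. A i j > 0" and p: "\<And>i. p i > 0"
  shows "(\<Sum>i\<in>UNIV. q i * ratio g A p i * (\<Sum>j\<in>UNIV. A i j * p j)) = (\<Sum>i\<in>UNIV. g i * p i * q i)"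
proof (rule sum.cong)
  fix i
  show "q i * ratio g A p i * (\<Sum>j\<in>UNIV. A i j * p j) = g i * p i * q i"
    using coupling_sum_pos[of A p i] A p by (simp add: ratio_def)
qed simp

text \<open>With \<open>?E\<close> the bilinear form of \<open>A\<close> at \<open>p\<close> and
  \<open>q\<close>, the common value of the two pairings is at least \<open>t * ?E\<close> and at
  most \<open>s * ?E\<close>; then \<open>?E > 0\<close> cancels.\<close>

lemma ratio_dual_le:
  assumes A: "\<And>i j. A i j > 0" and p: "\<And>i. p i > 0" and q: "\<And>i. q i > 0"
    and s: "\<And>i. ratio g A q i \<le> s" and t: "\<And>i. t \<le> ratio g (\<lambda>i j. A j i) p i"
  shows "t \<le> s"
proof -
  let ?E = "\<Sum>i\<in>UNIV. \<Sum>j\<in>UNIV. p i * A i j * q j"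
  have E: "?E > 0"
    using A p q by (intro sum_pos) auto
  have "t * ?E = (\<Sum>i\<in>UNIV. q i * t * (\<Sum>j\<in>UNIV. A j i * p j))"
    by (subst sum.swap) (simp add: sum_distrib_left mult_ac)
  also have "\<dots> \<le> (\<Sum>i\<in>UNIV. q i * ratio g (\<lambda>i j. A j i) p i * (\<Sum>j\<in>UNIV. A j i * p j))"
    using q t coupling_sum_pos[of "\<lambda>i j. A j i" p] A p
    by (intro sum_mono mult_right_mono mult_left_mono) (auto simp: less_imp_le)
  also have "\<dots> = (\<Sum>i\<in>UNIV. p i * ratio g A q i * (\<Sum>j\<in>UNIV. A i j * q j))"
    using ratio_pairing[of "\<lambda>i j. A j i" p q g] ratio_pairing[of A q p g] A p q
    by (simp add: mult_ac)
  also have "\<dots> \<le> (\<Sum>i\<in>UNIV. p i * s * (\<Sum>j\<in>UNIV. A i j * q j))"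
    using p s coupling_sum_pos[of A q] A q
    by (intro sum_mono mult_right_mono mult_left_mono) (auto simp: less_imp_le)
  also have "\<dots> = s * ?E"
    by (simp add: sum_distrib_left mult_ac)
  finally show ?thesis using E by simp
qed

text \<open>A positive lower bound on the ratios forces every gain to be positive, so a balanced
  \<open>q\<close> exists. Taking the transpose of \<open>A\<close> in place of \<open>A\<close>
  gives the opposite direction.\<close>

lemma ratio_dual_dominated:
  assumes A: "\<And>i j. A i j > 0" and p: "\<And>i. p i > 0"
    and t: "t > 0" "\<And>i. t \<le> ratio g (\<lambda>i j. A j i) p i"
  obtains s q where "t \<le> s" "\<And>i. q i > 0" "\<And>i. ratio g A q i = s"
proof -
  have "g i > 0" for i
  proof -
    have "0 < g i * p i / (\<Sum>j\<in>UNIV. A j i * p j)"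
      using t(1) t(2)[of i] by (simp add: ratio_def)
    then show ?thesis
      using coupling_sum_pos[of "\<lambda>i j. A j i" p i] A p[of i] p
      by (simp add: zero_less_divide_iff zero_less_mult_iff)
  qed
  then obtain s q where q: "\<And>i. q i > 0" "\<And>i. ratio g A q i = s"
    using ratio_eigenvector[of A g] A by metis
  have "t \<le> s"
    by (rule ratio_dual_le[of A p q g s t]) (use A p q t in auto)
  from this q show ?thesis by (rule that)
qed

section \<open>The two links\<close>

lemma le_min_over_pairs_iff: "t \<le> min_over_pairs f \<longleftrightarrow> (\<forall>k l. t \<le> f k l)"
  by (auto simp: min_over_pairs_def)

lemma less_min_over_pairs_iff: "t < min_over_pairs f \<longleftrightarrow> (\<forall>k l. t < f k l)"
  by (auto simp: min_over_pairs_def)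

lemma min_over_pairs_const: "(\<And>k l. f k l = c) \<Longrightarrow> min_over_pairs f = c"
  by (simp add: min_over_pairs_def split_def)

text \<open>Induction over nonempty finite sets of pairs reduces \<open>Min\<close> to the binary
  minimum.\<close>

lemma continuous_on_min_over_pairs:
  assumes "\<And>k l. continuous_on X (\<lambda>x. f x k l)"
  shows "continuous_on X (\<lambda>x. min_over_pairs (f x))"
proof -
  have "continuous_on X (\<lambda>x. Min ((\<lambda>(k, l). f x k l) ` S))" if "finite S" "S \<noteq> {}" for S
    using that
  proof (induction rule: finite_ne_induct)
    case (singleton i)
    then show ?case using assms by (cases i) simp
  next
    case (insert i S)
    have "continuous_on X (\<lambda>x. min (case i of (k, l) \<Rightarrow> f x k l) (Min ((\<lambda>(k, l). f x k l) ` S)))"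
      using assms insert by (cases i) (simp add: continuous_on_min)
    then show ?case using insert by simp
  qed
  then show ?thesis unfolding min_over_pairs_def by simp
qed

text \<open>The diagonal part contributes a weighted sum of squares and the rank-one part a single
  square, which makes positive definiteness visible.\<close>

lemma Qmat_quadratic_form:
  "x \<bullet> (Qmat M \<rho>\<^sub>f \<rho>\<^sub>r \<tau> \<beta> k l n *v x) =
     (\<Sum>j\<in>UNIV. bcoef \<rho>\<^sub>f \<rho>\<^sub>r \<tau> \<beta> k l n j * (x $ j)\<^sup>2) / real M
       + (if k = n then (bvec \<beta> k l \<bullet> x)\<^sup>2 else 0)"
proof -
  have "((\<chi> i j. if i = j then bcoef \<rho>\<^sub>f \<rho>\<^sub>r \<tau> \<beta> k l n j else 0) *v x) $ i
      = bcoef \<rho>\<^sub>f \<rho>\<^sub>r \<tau> \<beta> k l n i * x $ i" for i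
    by (simp add: matrix_vector_mult_def if_distrib[of "\<lambda>a. a * _"] cong: if_cong)
  then have diag: "x \<bullet> ((\<chi> i j. if i = j then bcoef \<rho>\<^sub>f \<rho>\<^sub>r \<tau> \<beta> k l n j else 0) *v x)
      = (\<Sum>j\<in>UNIV. bcoef \<rho>\<^sub>f \<rho>\<^sub>r \<tau> \<beta> k l n j * (x $ j)\<^sup>2)"
    by (simp add: inner_vec_def power2_eq_square mult_ac)
  have rank1: "x \<bullet> ((\<chi> i j. bvec \<beta> k l $ i * bvec \<beta> k l $ j) *v x) = (bvec \<beta> k l \<bullet> x)\<^sup>2"
    by (simp add: inner_vec_def matrix_vector_mult_def power2_eq_square sum_product
        sum_distrib_left mult_ac)
  show ?thesis
    unfolding Qmat_def
    by (simp add: matrix_vector_mult_add_rdistrib inner_add_right diag rank1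
        flip: scaleR_matrix_vector_assoc)
qed

section \<open>Both links in terms of one coupling matrix\<close>

locale cell_free =
  fixes M :: nat
    and \<rho>\<^sub>f \<rho>\<^sub>r \<tau> :: real
    and \<beta> :: "'k::finite \<Rightarrow> 'l::finite \<Rightarrow> 'l \<Rightarrow> real"
  assumes M_pos: "M > 0" and \<rho>\<^sub>f_pos: "\<rho>\<^sub>f > 0" and \<rho>\<^sub>r_pos: "\<rho>\<^sub>r > 0" and \<tau>_pos: "\<tau> > 0"
    and \<beta>_pos: "\<beta> k l j > 0"
begin

abbreviation "Q \<equiv> Qmat M \<rho>\<^sub>f \<rho>\<^sub>r \<tau> \<beta>"
abbreviation "down \<equiv> SINR_down M \<rho>\<^sub>f \<rho>\<^sub>r \<tau> \<beta>"
abbreviation "up \<equiv> SINR_up M \<rho>\<^sub>f \<rho>\<^sub>r \<tau> \<beta>"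
abbreviation "D \<equiv> down_values M \<rho>\<^sub>f \<rho>\<^sub>r \<tau> \<beta>"
abbreviation "U \<equiv> up_values M \<rho>\<^sub>f \<rho>\<^sub>r \<tau> \<beta>"

definition gain :: "('k \<Rightarrow> 'l \<Rightarrow> real ^ 'l) \<Rightarrow> 'k \<times> 'l \<Rightarrow> real" where
  "gain v = (\<lambda>(k, l). (bvec \<beta> k l \<bullet> v k l)\<^sup>2)"

text \<open>The row is the pair whose downlink ratio is formed, the column the pair whose beam
  enters. In the uplink the beam belongs to the pair whose ratio is formed, hence the
  transpose.\<close>

definition coupling :: "('k \<Rightarrow> 'l \<Rightarrow> real ^ 'l) \<Rightarrow> 'k \<times> 'l \<Rightarrow> 'k \<times> 'l \<Rightarrow> real" where
  "coupling v = (\<lambda>(k, l) (n, j). v n j \<bullet> (Q k l n *v v n j))"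

lemma Q_posdef:
  assumes "x \<noteq> 0"
  shows "x \<bullet> (Q k l n *v x) > 0"
proof -
  have c: "bcoef \<rho>\<^sub>f \<rho>\<^sub>r \<tau> \<beta> k l n j > 0" for j
    unfolding bcoef_def
    using \<rho>\<^sub>f_pos \<rho>\<^sub>r_pos \<tau>_pos \<beta>_pos
    by (intro mult_pos_pos add_pos_pos sum_pos divide_pos_pos) auto
  obtain j where j: "x $ j \<noteq> 0"
    using assms by (metis vec_eq_iff zero_index)
  have "(\<Sum>j\<in>UNIV. bcoef \<rho>\<^sub>f \<rho>\<^sub>r \<tau> \<beta> k l n j * (x $ j)\<^sup>2) > 0"
    using c j by (intro sum_pos2[of _ j]) (auto simp: less_imp_le)
  then show ?thesis
    unfolding Qmat_quadratic_form using M_pos by (simp add: add_pos_nonneg)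
qed

lemma coupling_pos: "(\<And>k l. v k l \<noteq> 0) \<Longrightarrow> coupling v i j > 0"
  by (simp add: coupling_def split_def Q_posdef)

lemma down_eq_ratio: "down v p k l = ratio (gain v) (coupling v) (\<lambda>(k, l). p k l) (k, l)"
  by (simp add: SINR_down_def ratio_def gain_def coupling_def sum.cartesian_product split_def
      flip: UNIV_Times_UNIV)

text \<open>Linearity moves the sum of matrices out of the quadratic form, leaving scalar
  coefficients of the powers as in the downlink.\<close>

lemma up_eq:
  "up w p k l = p k l * (bvec \<beta> k l \<bullet> w k l)\<^sup>2 /
     (\<Sum>n\<in>UNIV. \<Sum>j\<in>UNIV. p n j * (w k l \<bullet> (Q n j k *v w k l)))"
proof -
  have mv: "(\<Sum>i\<in>S. f i) *v x = (\<Sum>i\<in>S. f i *v x)"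
    if "finite S" for S :: "'c set" and f :: "'c \<Rightarrow> real ^ 'l ^ 'l" and x :: "real^'l"
    using that by (induction) (auto simp: matrix_vector_mult_add_rdistrib)
  show ?thesis
    by (simp add: SINR_up_def mv inner_sum_right flip: scaleR_matrix_vector_assoc)
qed

lemma up_eq_ratio: "up w p k l = ratio (gain w) (\<lambda>i j. coupling w j i) (\<lambda>(k, l). p k l) (k, l)"
  by (simp add: up_eq ratio_def gain_def coupling_def sum.cartesian_product split_def mult.commute
      flip: UNIV_Times_UNIV)

text \<open>Only the beam of the pair itself enters its uplink ratio, so
  \<open>(c k l)\<^sup>2\<close> appears in numerator and denominator alike.\<close>

lemma up_scale_beams:
  assumes "\<And>k l. c k l \<noteq> 0"
  shows "up (\<lambda>k l. c k l *\<^sub>R w k l) p k l = up w p k l"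
proof -
  have "(\<Sum>n\<in>UNIV. \<Sum>j\<in>UNIV. p n j * ((c k l *\<^sub>R w k l) \<bullet> (Q n j k *v (c k l *\<^sub>R w k l)))) =
      (c k l)\<^sup>2 * (\<Sum>n\<in>UNIV. \<Sum>j\<in>UNIV. p n j * (w k l \<bullet> (Q n j k *v w k l)))"
    by (simp add: sum_distrib_left power2_eq_square mult_ac matrix_vector_mult_scaleR)
  then show ?thesis
    using assms[of k l] by (simp add: up_eq power_mult_distrib)
qed

lemma up_scale_powers:
  assumes "c \<noteq> 0"
  shows "up w (\<lambda>k l. c * p k l) k l = up w p k l"
proof -
  have "(\<Sum>n\<in>UNIV. \<Sum>j\<in>UNIV. c * p n j * (w k l \<bullet> (Q n j k *v w k l))) =
      c * (\<Sum>n\<in>UNIV. \<Sum>j\<in>UNIV. p n j * (w k l \<bullet> (Q n j k *v w k l)))"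
    by (simp add: sum_distrib_left mult_ac)
  then show ?thesis
    using assms by (simp add: up_eq)
qed

section \<open>Each link dominates the other\<close>

text \<open>The beams \<open>w\<close> are kept and only the powers change, as the transfer of
  optimal uplink beams to the downlink requires.\<close>

lemma down_dominates_up:
  assumes "\<And>k l. norm (w k l) = 1" "\<And>k l. p k l > 0" "t > 0" "\<And>k l. t \<le> up w p k l"
  obtains s q where "t \<le> s" "\<And>k l. q k l > 0" "\<And>k l. down w q k l = s"
proof -
  have w0: "\<And>k l. w k l \<noteq> 0" using assms(1) by (metis norm_zero zero_neq_one)
  have A: "\<And>i j. coupling w i j > 0"
    using w0 by (rule coupling_pos)
  have p: "\<And>i. (case i of (k, l) \<Rightarrow> p k l) > 0"
    using assms(2) by auto
  have t: "\<And>i. t \<le> ratio (gain w) (\<lambda>i j. coupling w j i) (\<lambda>(k, l). p k l) i"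
    using assms(4) by (auto simp: up_eq_ratio)
  obtain s q where "t \<le> s" "\<And>i. q i > 0" "\<And>i. ratio (gain w) (coupling w) q i = s"
    using ratio_dual_dominated[OF A p assms(3) t] by blast
  then show ?thesis
    by (intro that[of s "\<lambda>k l. q (k, l)"]) (auto simp: down_eq_ratio)
qed

lemma up_dominates_down:
  assumes v0: "\<And>k l. v k l \<noteq> 0" and "\<And>k l. p k l > 0" "t > 0" "\<And>k l. t \<le> down v p k l"
  shows "\<exists>s\<in>U. t \<le> s"
proof -
  have A: "\<And>i j. coupling v j i > 0"
    using v0 by (rule coupling_pos)
  have p: "\<And>i. (case i of (k, l) \<Rightarrow> p k l) > 0"
    using assms(2) by auto
  have t: "\<And>i. t \<le> ratio (gain v) (coupling v) (\<lambda>(k, l). p k l) i"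
    using assms(4) by (auto simp: down_eq_ratio)
  obtain s q where sq: "t \<le> s" "\<And>i. q i > 0"
    "\<And>i. ratio (gain v) (\<lambda>i j. coupling v j i) q i = s"
    using ratio_dual_dominated[of "\<lambda>i j. coupling v j i", OF A p assms(3) t] by blast
  \<comment> \<open>Uplink beams must have norm one; rescaling the beams leaves all uplink ratios
    unchanged.\<close>
  let ?w = "\<lambda>k l. (1 / norm (v k l)) *\<^sub>R v k l"
  have "up ?w (\<lambda>k l. q (k, l)) k l = s" for k l
  proof -
    have "up ?w (\<lambda>k l. q (k, l)) k l = up v (\<lambda>k l. q (k, l)) k l"
      using v0 by (intro up_scale_beams) simp
    then show ?thesis using sq(3) by (simp add: up_eq_ratio)
  qed
  then have "min_over_pairs (up ?w (\<lambda>k l. q (k, l))) = s"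
    by (rule min_over_pairs_const)
  moreover have "\<forall>k l. norm (?w k l) = 1" using v0 by simp
  ultimately have "s \<in> U"
    unfolding up_values_def using sq(2) by blast
  with sq(1) show ?thesis by blast
qed

section \<open>Existence and positivity of the uplink maximum\<close>

text \<open>Matched beams, the normalised \<open>bvec \<beta> k l\<close>, together with unit powers
  make every numerator positive.\<close>

lemma up_values_positive: "\<exists>t\<in>U. t > 0"
proof -
  have b0: "bvec \<beta> k l \<noteq> 0" for k l
    using \<beta>_pos[of k l] by (auto simp: bvec_def vec_eq_iff less_le)
  let ?b = "\<lambda>k l. bvec \<beta> k l" and ?one = "\<lambda>k l. 1 :: real"
  let ?w = "\<lambda>k l. (1 / norm (bvec \<beta> k l)) *\<^sub>R bvec \<beta> k l"
  have "up ?w ?one k l > 0" for k l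
  proof -
    have "up ?w ?one k l = up ?b ?one k l"
      using b0 by (intro up_scale_beams) simp
    also have "\<dots> > 0"
      using b0 by (simp add: up_eq Q_posdef sum_pos)
    finally show ?thesis .
  qed
  then have "min_over_pairs (up ?w ?one) > 0"
    by (simp add: less_min_over_pairs_iff)
  moreover have "\<forall>k l. norm (?w k l) = 1" using b0 by simp
  then have "min_over_pairs (up ?w ?one) \<in> U"
    unfolding up_values_def by fastforce
  ultimately show ?thesis by blast
qed

lemma up_maximum_exists: "\<exists>s. is_maximum s U \<and> s > 0"
proof -
  \<comment> \<open>Beams and powers become vectors indexed by pairs, so that compactness in
    Euclidean space applies. The closed simplex also admits zero powers, which \<open>U\<close>
    excludes.\<close>
  let ?W = "{w :: (real ^ 'l) ^ ('k \<times> 'l). \<forall>i. norm (w $ i) = 1}"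
  let ?X = "?W \<times> (unit_simplex :: (real ^ ('k \<times> 'l)) set)"
  let ?beams = "\<lambda>w :: (real ^ 'l) ^ ('k \<times> 'l). \<lambda>k l. w $ (k, l)"
  let ?pows = "\<lambda>p :: real ^ ('k \<times> 'l). \<lambda>k l. p $ (k, l)"
  let ?F = "\<lambda>x. min_over_pairs (up (?beams (fst x)) (?pows (snd x)))"
  have "closed ?W"
    by (intro closed_Collect_all closed_Collect_eq continuous_intros)
  moreover have "bounded ?W"
  proof (rule boundedI)
    fix w :: "(real ^ 'l) ^ ('k \<times> 'l)" assume "w \<in> ?W"
    have "norm w \<le> (\<Sum>i\<in>UNIV. norm (w $ i))"
      unfolding norm_vec_def[of w] by (rule L2_set_le_sum) simp
    also have "\<dots> = real CARD('k \<times> 'l)"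
      using \<open>w \<in> ?W\<close> by (simp only: mem_Collect_eq) simp
    finally show "norm w \<le> real CARD('k \<times> 'l)" .
  qed
  ultimately have "compact ?X"
    using compact_eq_bounded_closed compact_unit_simplex compact_Times by blast
  have denom: "(\<Sum>n\<in>UNIV. \<Sum>j\<in>UNIV. p $ (n, j) * (w $ (k, l) \<bullet> (Q n j k *v w $ (k, l)))) > 0"
    if "(w, p) \<in> ?X" for w p k l
  proof -
    have "norm (w $ (k, l)) = 1" using that by simp
    then have "w $ (k, l) \<noteq> 0" by force
    then have "(\<Sum>i\<in>UNIV. (w $ (k, l) \<bullet> (Q (fst i) (snd i) k *v w $ (k, l))) * p $ i) > 0"
      using that by (intro unit_simplex_sum_pos Q_posdef) auto
    then show ?thesis
      by (simp add: sum.cartesian_product split_def mult.commute flip: UNIV_Times_UNIV)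
  qed
  have cont: "continuous_on ?X ?F"
  proof (rule continuous_on_min_over_pairs, unfold up_eq, rule continuous_on_divide)
    fix k l
    show "continuous_on ?X
      (\<lambda>x. ?pows (snd x) k l * (bvec \<beta> k l \<bullet> ?beams (fst x) k l)\<^sup>2)"
      by (intro continuous_intros)
    show "continuous_on ?X (\<lambda>x. \<Sum>n\<in>UNIV. \<Sum>j\<in>UNIV. ?pows (snd x) n j *
        (?beams (fst x) k l \<bullet> (Q n j k *v ?beams (fst x) k l)))"
      by (intro continuous_intros bounded_linear.continuous_on[OF matrix_vector_mul_bounded_linear])
    show "\<forall>x\<in>?X. (\<Sum>n\<in>UNIV. \<Sum>j\<in>UNIV. ?pows (snd x) n j *
        (?beams (fst x) k l \<bullet> (Q n j k *v ?beams (fst x) k l))) \<noteq> 0"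
      using denom by (force simp: less_le)
  qed
  have U_attained: "\<exists>x\<in>?X. ?F x = t" if "t \<in> U" for t
  proof -
    from that obtain w p where w: "\<forall>k l. norm (w k l) = 1" and p: "\<forall>k l. p k l > 0"
      and t: "t = min_over_pairs (up w p)"
      unfolding up_values_def by blast
    let ?c = "\<Sum>i\<in>UNIV. case i of (k, l) \<Rightarrow> p k l"
    have c: "?c > 0" using p by (intro sum_pos) auto
    \<comment> \<open>Dividing by the total power \<open>?c\<close> puts the powers in the simplex
      and changes no ratio.\<close>
    let ?x = "(\<chi> i. case i of (k, l) \<Rightarrow> w k l, \<chi> i. case i of (k, l) \<Rightarrow> (1 / ?c) * p k l)"
    have "(\<Sum>i\<in>UNIV. case i of (k, l) \<Rightarrow> (1 / ?c) * p k l) = (1 / ?c) * ?c"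
      by (simp only: sum_distrib_left split_def)
    then have "(\<Sum>i\<in>UNIV. case i of (k, l) \<Rightarrow> (1 / ?c) * p k l) = 1"
      using c by simp
    moreover have "0 \<le> (1 / ?c) * p k l" for k l
      using c p by (simp add: less_imp_le)
    ultimately have "?x \<in> ?X"
      using w by (simp add: unit_simplex_def split_def)
    moreover have "up w (\<lambda>k l. (1 / ?c) * p k l) = up w p"
      using c by (intro ext up_scale_powers) simp
    then have "?F ?x = t"
      by (simp only: fst_conv snd_conv vec_lambda_beta prod.case t)
    ultimately show ?thesis by blast
  qed
  have "?X \<noteq> {}" using U_attained up_values_positive by blast
  then obtain x where x: "x \<in> ?X" "\<And>y. y \<in> ?X \<Longrightarrow> ?F y \<le> ?F x"
    using continuous_attains_sup[OF \<open>compact ?X\<close> _ cont] by blast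
  have le: "t \<le> ?F x" if "t \<in> U" for t using U_attained[OF that] x(2) by blast
  have pos: "?F x > 0" using up_values_positive le by force
  obtain w p where wp: "x = (w, p)" by (cases x)
  \<comment> \<open>A zero power would make the ratio of its pair zero, against the positive
    minimum; so the maximiser is admissible for \<open>U\<close>.\<close>
  have "p $ (k, l) > 0" for k l
  proof -
    have "up (?beams w) (?pows p) k l > 0"
      using pos by (simp add: less_min_over_pairs_iff wp)
    then have "p $ (k, l) \<noteq> 0" by (auto simp: up_eq)
    then show ?thesis using x(1) by (simp add: wp unit_simplex_def less_le)
  qed
  moreover have "\<forall>k l. norm (?beams w k l) = 1" using x(1) by (simp add: wp)
  ultimately have "?F x \<in> U"
    unfolding up_values_def wp by auto
  with le pos show ?thesis unfolding is_maximum_def by blast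
qed

section \<open>Equality of the two maxima and transfer of optimal beams\<close>

lemma duality:
  "\<exists>s. s > 0 \<and> is_maximum s U \<and> is_maximum s D \<and>
    (\<forall>w p. (\<forall>k l. norm (w k l) = 1) \<longrightarrow> (\<forall>k l. p k l > 0) \<longrightarrow> (\<forall>k l. up w p k l = s) \<longrightarrow>
      (\<exists>q. (\<forall>k l. q k l > 0) \<and> (\<forall>k l. down w q k l = s)))"
proof -
  obtain s where max: "is_maximum s U" and s: "s > 0"
    using up_maximum_exists by blast
  have D_le: "t \<le> s" if "t \<in> D" for t
  \<comment> \<open>Domination by the uplink is available for positive \<open>t\<close>; other
    values lie below \<open>s > 0\<close>.\<close>
  proof (cases "t > 0")
    case True
    from that obtain v p where "\<forall>k l. v k l \<noteq> 0" "\<forall>k l. p k l > 0"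
      and t: "t = min_over_pairs (down v p)"
      unfolding down_values_def by blast
    then have v: "\<And>k l. v k l \<noteq> 0" "\<And>k l. p k l > 0" by auto
    have "t \<le> down v p k l" for k l
      using t by (metis le_min_over_pairs_iff order_refl)
    from up_dominates_down[OF v(1,2) True this] show ?thesis
      using max unfolding is_maximum_def by force
  qed (use s in simp)
  \<comment> \<open>The bound \<open>s \<le> up w p k l\<close> covers both uses: powers attaining
    the maximum, whose ratios may be unequal, and powers with all ratios equal to
    \<open>s\<close>.\<close>
  have bal: "\<exists>q. (\<forall>k l. q k l > 0) \<and> (\<forall>k l. down w q k l = s)"
    and in_D: "s \<in> D"
    if w: "\<And>k l. norm (w k l) = 1" and p: "\<And>k l. p k l > 0" and up: "\<And>k l. s \<le> up w p k l"
    for w p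
  proof -
    obtain s' q where q: "s \<le> s'" "\<And>k l. q k l > 0" "\<And>k l. down w q k l = s'"
      using down_dominates_up[OF w p s up] by metis
    have "\<forall>k l. w k l \<noteq> 0" using w by (metis norm_zero zero_neq_one)
    moreover have "min_over_pairs (down w q) = s'"
      using q(3) by (rule min_over_pairs_const)
    ultimately have "s' \<in> D"
      using q(2) unfolding down_values_def by blast
    \<comment> \<open>The balanced downlink value \<open>s'\<close> is at least \<open>s\<close> by
      domination and, as an element of \<open>D\<close>, at most \<open>s\<close>.\<close>
    moreover from this have "s' = s" using D_le q(1) by force
    ultimately show "s \<in> D" "\<exists>q. (\<forall>k l. q k l > 0) \<and> (\<forall>k l. down w q k l = s)"
      using q by auto
  qed
  obtain w p where "\<And>k l. norm (w k l) = 1" "\<And>k l. p k l > 0" "s = min_over_pairs (up w p)"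
    using max unfolding is_maximum_def up_values_def by blast
  then have "s \<in> D"
    by (intro in_D[of w p]) (use le_min_over_pairs_iff[of s "up w p"] in blast)+
  then have "is_maximum s D" using D_le unfolding is_maximum_def by blast
  moreover have "\<exists>q. (\<forall>k l. q k l > 0) \<and> (\<forall>k l. down w q k l = s)"
    if "\<forall>k l. norm (w k l) = 1" "\<forall>k l. p k l > 0" "\<forall>k l. up w p k l = s" for w p
    using that by (intro bal[of w p]) simp_all
  ultimately show ?thesis using s max by blast
qed

end

lemma Greatest_is_maximum: "is_maximum s A \<Longrightarrow> (GREATEST x. x \<in> A) = s"
  unfolding is_maximum_def by (intro Greatest_equality) auto

theorem theorem6:
  fixes M :: nat
    and \<rho>\<^sub>f \<rho>\<^sub>r \<tau> :: real
    and \<beta> :: "'k::finite \<Rightarrow> 'l::finite \<Rightarrow> 'l \<Rightarrow> real"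
  assumes "M > 0" and "\<rho>\<^sub>f > 0" and "\<rho>\<^sub>r > 0" and "\<tau> > 0"
    and "\<And>k l j. \<beta> k l j > 0"
  shows "is_maximum (S_down M \<rho>\<^sub>f \<rho>\<^sub>r \<tau> \<beta>) (down_values M \<rho>\<^sub>f \<rho>\<^sub>r \<tau> \<beta>) \<and>
    is_maximum (S_up M \<rho>\<^sub>f \<rho>\<^sub>r \<tau> \<beta>) (up_values M \<rho>\<^sub>f \<rho>\<^sub>r \<tau> \<beta>) \<and>
    S_down M \<rho>\<^sub>f \<rho>\<^sub>r \<tau> \<beta> = S_up M \<rho>\<^sub>f \<rho>\<^sub>r \<tau> \<beta> \<and>
    (\<forall>w pU.
      (\<forall>k l. norm (w k l) = 1) \<longrightarrow> (\<forall>k l. pU k l > 0) \<longrightarrow>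
      (\<forall>n v. SINR_up M \<rho>\<^sub>f \<rho>\<^sub>r \<tau> \<beta> w pU n v = S_up M \<rho>\<^sub>f \<rho>\<^sub>r \<tau> \<beta>) \<longrightarrow>
      (\<exists>p. (\<forall>k l. p k l > 0) \<and>
        (\<forall>n v. SINR_down M \<rho>\<^sub>f \<rho>\<^sub>r \<tau> \<beta> w p n v = S_down M \<rho>\<^sub>f \<rho>\<^sub>r \<tau> \<beta>)))"
proof -
  interpret cell_free M \<rho>\<^sub>f \<rho>\<^sub>r \<tau> \<beta>
    using assms by unfold_locales
  obtain s where s: "is_maximum s U" "is_maximum s D"
    and bal: "\<forall>w p. (\<forall>k l. norm (w k l) = 1) \<longrightarrow> (\<forall>k l. p k l > 0) \<longrightarrow> (\<forall>k l. up w p k l = s) \<longrightarrow>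
      (\<exists>q. (\<forall>k l. q k l > 0) \<and> (\<forall>k l. down w q k l = s))"
    using duality by blast
  have "S_up M \<rho>\<^sub>f \<rho>\<^sub>r \<tau> \<beta> = s" "S_down M \<rho>\<^sub>f \<rho>\<^sub>r \<tau> \<beta> = s"
    using s by (simp_all add: S_up_def S_down_def Greatest_is_maximum)
  with s bal show ?thesis by simp
qed

end
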